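(* Let $\mathcal{L}=p+\sum_{n\ge1}u_np^{-n}$ and $\mathcal{M}=\sum_{n\ge1}nt_n\mathcal{L}^{n-1}+\sum_{n\ge1}v_n\mathcal{L}^{-n}$ satisfy the Lax-Sato equations $$\frac{\partial\psi}{\partial t_n}=A_n\frac{\partial\psi}{\partial x}-B_n\frac{\partial\psi}{\partial p},\qquad \psi=\begin{pmatrix}\mathcal{L}\\ \mathcal{M}\end{pmatrix},\quad n\ge1,$$ with $A_n=(J_0^{-1}\,\partial\mathcal{L}^n/\partial p)_+$, $B_n=(J_0^{-1}\,\partial\mathcal{L}^n/\partial x)_+$. Then the function $J_0=\partial_p\mathcal{L}\,\partial_x\mathcal{M}-\partial_x\mathcal{L}\,\partial_p\mathcal{M}$ and its inverse $G=J_0^{-1}$ satisfy, for every $n\ge1$, $$\partial_{t_n}J_0=\partial_x(A_nJ_0)-\partial_p(B_nJ_0),$$ $$\partial_{t_n}G=\langle A_n,G\rangle_x-\langle B_n,G\rangle_p,$$ where $\langle U,V\rangle_i:=U(\partial_iV)-(\partial_iU)V$ for $i\in\{x,p\}$.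
   Context: The coefficients $u_n,v_n$ ($n\ge1$) are smooth functions of $x$ and of the times $t_1,t_2,t_3,\dots$; $p$ is a formal (spectral) variable. $\mathcal{L}$ is a formal Laurent series in $p$ (finitely many positive powers). For a Laurent series in $p$, $(\cdot)_+$ denotes the projection onto the polynomial part (non-negative powers of $p$). The sum $\sum_n nt_n\mathcal{L}^{n-1}$ in $\mathcal{M}$ is formal (one may take only finitely many nonzero $t_n$). Convention: $x$ is identified with the first time, i.e. $t_1$ and $x$ enter only through $t_1+x$ (so the first term of $\mathcal{M}$ is really $t_1+x$). Thus the derivative of $\mathcal{M}$ in $x$ with $\mathcal{L}$ held fixed is $1+\sum_{n\ge1}v_{nx}\mathcal{L}^{-n}$, the derivative in $t_m$ with $\mathcal{L}$ held fixed is $m\mathcal{L}^{m-1}+\sum_{n\ge1}v_{n t_m}\mathcal{L}^{-n}$, and full derivatives of $\mathcal{M}$ at fixed $p$ are obtained from these by the chain rule through $\mathcal{L}$. Consequently $J_0=\frac{\partial\mathcal{L}}{\partial p}\bigl(1+\sum_{n\ge1}v_{nx}\mathcal{L}^{-n}\bigr)=1+v_{1x}p^{-1}+(v_{2x}-u_1)p^{-2}+\cdots$, which is invertible as a series in $p^{-1}$. *)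

theory Defs
  imports "HOL-Analysis.Analysis" "HOL-Computational_Algebra.Formal_Laurent_Series"
begin

text \<open>
  A point \<open>z\<close> packs the independent variables: \<open>z 0\<close> is \<open>x\<close> and \<open>z n\<close> is the time \<open>t\<^sub>n\<close>
  for \<open>n \<ge> 1\<close>. Only points with finitely many nonzero entries are considered. A Laurent
  series in \<open>p\<close> with finitely many positive powers is an element of \<^typ>\<open>real fls\<close> whose
  formal variable \<^term>\<open>fls_X\<close> stands for \<open>p\<^sup>-\<^sup>1\<close>; the coefficient of \<open>p\<^sup>k\<close> in \<open>f\<close> is
  therefore \<open>fls_nth f (- k)\<close>.
\<close>

type_synonym point = "nat \<Rightarrow> real"
type_synonym series = "point \<Rightarrow> real fls"

text \<open>
  The space of points is the increasing union of the finite-dimensional spaces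
  \<open>slice N\<close>; openness and smoothness refer to this inductive limit. On each slice the
  product topology of \<^typ>\<open>nat \<Rightarrow> real\<close> is the Euclidean one.
\<close>

definition slice :: "nat \<Rightarrow> point set" where
  "slice N = {z. \<forall>i>N. z i = 0}"

definition open_domain :: "point set \<Rightarrow> bool" where
  "open_domain D \<longleftrightarrow>
     D \<subseteq> (\<Union>N. slice N) \<and> (\<forall>N. openin (top_of_set (slice N)) (D \<inter> slice N))"

definition pderiv_at :: "nat \<Rightarrow> (point \<Rightarrow> real) \<Rightarrow> point \<Rightarrow> real" where
  "pderiv_at i f z = deriv (\<lambda>s. f (z(i := s))) (z i)"

definition pderivs :: "nat list \<Rightarrow> (point \<Rightarrow> real) \<Rightarrow> point \<Rightarrow> real" where
  "pderivs is f = foldr pderiv_at is f"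

definition smooth_in :: "point set \<Rightarrow> (point \<Rightarrow> real) \<Rightarrow> bool" where
  "smooth_in D f \<longleftrightarrow> (\<forall>is.
     (\<forall>N. continuous_on (D \<inter> slice N) (pderivs is f)) \<and>
     (\<forall>z\<in>D. \<forall>i. (\<lambda>s. pderivs is f (z(i := s))) differentiable (at (z i))))"

text \<open>The convention that \<open>x\<close> and \<open>t\<^sub>1\<close> enter only through \<open>t\<^sub>1 + x\<close>.\<close>

definition via_t1_plus_x :: "point set \<Rightarrow> (point \<Rightarrow> real) \<Rightarrow> bool" where
  "via_t1_plus_x D f \<longleftrightarrow> (\<forall>z\<in>D. \<forall>w\<in>D.
     z 0 + z 1 = w 0 + w 1 \<and> (\<forall>n\<ge>2. z n = w n) \<longrightarrow> f z = f w)"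

text \<open>
  Partial derivatives of series at fixed \<open>p\<close> are taken coefficientwise. In \<open>Dp\<close>,
  \<open>d/dp = - X\<^sup>2 d/dX\<close> because \<open>X = p\<^sup>-\<^sup>1\<close>.
\<close>

definition Dvar :: "nat \<Rightarrow> series \<Rightarrow> series" where
  "Dvar i F z = Abs_fls (\<lambda>k. pderiv_at i (\<lambda>w. fls_nth (F w) k) z)"

abbreviation Dx :: "series \<Rightarrow> series" where
  "Dx \<equiv> Dvar 0"

abbreviation Dt :: "nat \<Rightarrow> series \<Rightarrow> series" where
  "Dt n \<equiv> Dvar n"

definition Dp :: "series \<Rightarrow> series" where
  "Dp F z = - (fls_X ^ 2 * fls_deriv (F z))"

lift_definition poly_part :: "real fls \<Rightarrow> real fls" is
  "\<lambda>f k. if k \<le> 0 then f k else 0"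
  by (auto elim!: MOST_mono)

text \<open>The infinite sums below converge in the \<open>X\<close>-adic metric of \<^typ>\<open>real fls\<close>.\<close>

definition Lax :: "(nat \<Rightarrow> point \<Rightarrow> real) \<Rightarrow> series" where
  "Lax u z = fls_X_inv + (\<Sum>n. fls_const (u (Suc n) z) * fls_X ^ Suc n)"

text \<open>The summand \<open>z 0\<close> is the \<open>x\<close> in \<open>(t\<^sub>1 + x) + 2 t\<^sub>2 L + 3 t\<^sub>3 L\<^sup>2 + \<dots>\<close>.\<close>

definition Orlov :: "(nat \<Rightarrow> point \<Rightarrow> real) \<Rightarrow> (nat \<Rightarrow> point \<Rightarrow> real) \<Rightarrow> series" where
  "Orlov u v z =
     fls_const (z 0)
     + (\<Sum>n\<in>{n. 1 \<le> n \<and> z n \<noteq> 0}. fls_const (real n * z n) * Lax u z ^ (n - 1))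
     + (\<Sum>n. fls_const (v (Suc n) z) * inverse (Lax u z) ^ Suc n)"

definition J0 :: "(nat \<Rightarrow> point \<Rightarrow> real) \<Rightarrow> (nat \<Rightarrow> point \<Rightarrow> real) \<Rightarrow> series" where
  "J0 u v z = Dp (Lax u) z * Dx (Orlov u v) z - Dx (Lax u) z * Dp (Orlov u v) z"

definition J0_inv :: "(nat \<Rightarrow> point \<Rightarrow> real) \<Rightarrow> (nat \<Rightarrow> point \<Rightarrow> real) \<Rightarrow> series" where
  "J0_inv u v z = inverse (J0 u v z)"

definition Acoef :: "(nat \<Rightarrow> point \<Rightarrow> real) \<Rightarrow> (nat \<Rightarrow> point \<Rightarrow> real) \<Rightarrow> nat \<Rightarrow> series" where
  "Acoef u v n z = poly_part (inverse (J0 u v z) * Dp (\<lambda>w. Lax u w ^ n) z)"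

definition Bcoef :: "(nat \<Rightarrow> point \<Rightarrow> real) \<Rightarrow> (nat \<Rightarrow> point \<Rightarrow> real) \<Rightarrow> nat \<Rightarrow> series" where
  "Bcoef u v n z = poly_part (inverse (J0 u v z) * Dx (\<lambda>w. Lax u w ^ n) z)"

definition lax_sato ::
  "point set \<Rightarrow> (nat \<Rightarrow> point \<Rightarrow> real) \<Rightarrow> (nat \<Rightarrow> point \<Rightarrow> real) \<Rightarrow> bool" where
  "lax_sato D u v \<longleftrightarrow> (\<forall>\<psi>\<in>{Lax u, Orlov u v}. \<forall>n\<ge>1. \<forall>z\<in>D.
     Dt n \<psi> z = Acoef u v n z * Dx \<psi> z - Bcoef u v n z * Dp \<psi> z)"

definition bracket :: "(series \<Rightarrow> series) \<Rightarrow> series \<Rightarrow> series \<Rightarrow> series" where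
  "bracket d U V z = U z * d V z - d U z * V z"

end

theory Submission
  imports Defs
begin

text \<open>
  Write \<open>J\<^sub>0 = {L, M}\<close> for the Poisson bracket in \<open>(p, x)\<close>. Differentiating it along
  \<open>t\<^sub>n\<close> and inserting the Lax--Sato equations for \<open>L\<close> and \<open>M\<close> gives the first equation by
  the Leibniz rule and the commutation of \<open>\<partial>\<^sub>x\<close>, \<open>\<partial>\<^sub>p\<close> and \<open>\<partial>\<^sub>t\<close>; the form of \<open>A\<^sub>n\<close>
  and \<open>B\<^sub>n\<close> plays no role beyond their differentiability. The second equation follows by
  differentiating \<open>J\<^sub>0 G = 1\<close>.

  The analytic content is that all series involved have differentiable coefficients. This is
  checked on one finite-dimensional slice containing the given point and the direction of
  \<open>t\<^sub>n\<close>: there the powers of \<open>p\<close> in \<open>M\<close> are bounded, and coefficients of products, of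
  infinite sums and of inverses of series with leading coefficient 1 are polynomials in the
  coefficients of the data. The leading coefficient of \<open>J\<^sub>0\<close> is 1 because the positive powers
  of \<open>L\<close> in \<open>M\<close> have zero bracket with \<open>L\<close>.
\<close>

unbundle fps_syntax

section \<open>Continuously differentiable functions on a slice\<close>

lemma mixed_partials_eq:
  fixes f f\<^sub>a f\<^sub>b f\<^sub>a\<^sub>b f\<^sub>b\<^sub>a :: "real \<Rightarrow> real \<Rightarrow> real"
  assumes r: "r > 0"
    and fa: "\<And>a b. \<bar>a - a0\<bar> < r \<Longrightarrow> \<bar>b - b0\<bar> < r \<Longrightarrow> ((\<lambda>s. f s b) has_real_derivative f\<^sub>a a b) (at a)"
    and fb: "\<And>a b. \<bar>a - a0\<bar> < r \<Longrightarrow> \<bar>b - b0\<bar> < r \<Longrightarrow> ((\<lambda>s. f a s) has_real_derivative f\<^sub>b a b) (at b)"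
    and fab: "\<And>a b. \<bar>a - a0\<bar> < r \<Longrightarrow> \<bar>b - b0\<bar> < r \<Longrightarrow> ((\<lambda>s. f\<^sub>a a s) has_real_derivative f\<^sub>a\<^sub>b a b) (at b)"
    and fba: "\<And>a b. \<bar>a - a0\<bar> < r \<Longrightarrow> \<bar>b - b0\<bar> < r \<Longrightarrow> ((\<lambda>s. f\<^sub>b s b) has_real_derivative f\<^sub>b\<^sub>a a b) (at a)"
    and cab: "isCont (\<lambda>(a, b). f\<^sub>a\<^sub>b a b) (a0, b0)"
    and cba: "isCont (\<lambda>(a, b). f\<^sub>b\<^sub>a a b) (a0, b0)"
  shows "f\<^sub>a\<^sub>b a0 b0 = f\<^sub>b\<^sub>a a0 b0"
proof (rule ccontr)
  \<comment> \<open>The mean value theorem evaluates the second difference over a small square in both orders.\<close>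
  assume "f\<^sub>a\<^sub>b a0 b0 \<noteq> f\<^sub>b\<^sub>a a0 b0"
  define e where "e = \<bar>f\<^sub>a\<^sub>b a0 b0 - f\<^sub>b\<^sub>a a0 b0\<bar> / 2"
  have e: "e > 0" using \<open>_ \<noteq> _\<close> by (simp add: e_def)
  obtain d1 where d1: "d1 > 0" "\<And>a b. dist (a, b) (a0, b0) < d1 \<Longrightarrow> \<bar>f\<^sub>a\<^sub>b a b - f\<^sub>a\<^sub>b a0 b0\<bar> < e"
    using cab e unfolding continuous_at_eps_delta dist_real_def by force
  obtain d2 where d2: "d2 > 0" "\<And>a b. dist (a, b) (a0, b0) < d2 \<Longrightarrow> \<bar>f\<^sub>b\<^sub>a a b - f\<^sub>b\<^sub>a a0 b0\<bar> < e"
    using cba e unfolding continuous_at_eps_delta dist_real_def by force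
  \<comment> \<open>A third of the minimum keeps \<open>2 * h\<close> below both radii, so by the l1
    bound in \<open>near\<close> all mean value points lie where the mixed partials vary by less
    than \<open>e\<close>.\<close>
  define h where "h = min r (min d1 d2) / 3"
  have h: "h > 0" "h < r" "2 * h < d1" "2 * h < d2"
    using r d1(1) d2(1) by (auto simp: h_def)
  have near: "dist (a, b) (a0, b0) < d1" "dist (a, b) (a0, b0) < d2"
    if "a0 < a" "a < a0 + h" "b0 < b" "b < b0 + h" for a b
  proof -
    have "dist (a, b) (a0, b0) \<le> \<bar>a - a0\<bar> + \<bar>b - b0\<bar>"
      by (simp add: dist_Pair_Pair dist_real_def sqrt_sum_squares_le_sum_abs)
    also have "\<dots> < 2 * h" using that by simp
    finally show "dist (a, b) (a0, b0) < d1" "dist (a, b) (a0, b0) < d2" using h by auto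
  qed
  obtain \<xi> where \<xi>: "a0 < \<xi>" "\<xi> < a0 + h"
    "(f (a0 + h) (b0 + h) - f (a0 + h) b0) - (f a0 (b0 + h) - f a0 b0)
       = (a0 + h - a0) * (f\<^sub>a \<xi> (b0 + h) - f\<^sub>a \<xi> b0)"
    using MVT2[of a0 "a0 + h" "\<lambda>a. f a (b0 + h) - f a b0" "\<lambda>a. f\<^sub>a a (b0 + h) - f\<^sub>a a b0"] h
    by (force intro!: DERIV_diff fa)
  obtain \<eta> where \<eta>: "b0 < \<eta>" "\<eta> < b0 + h"
    "f\<^sub>a \<xi> (b0 + h) - f\<^sub>a \<xi> b0 = (b0 + h - b0) * f\<^sub>a\<^sub>b \<xi> \<eta>"
    using MVT2[of b0 "b0 + h" "f\<^sub>a \<xi>" "f\<^sub>a\<^sub>b \<xi>"] h \<xi> by (force intro!: fab)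
  obtain \<eta>' where \<eta>': "b0 < \<eta>'" "\<eta>' < b0 + h"
    "(f (a0 + h) (b0 + h) - f a0 (b0 + h)) - (f (a0 + h) b0 - f a0 b0)
       = (b0 + h - b0) * (f\<^sub>b (a0 + h) \<eta>' - f\<^sub>b a0 \<eta>')"
    using MVT2[of b0 "b0 + h" "\<lambda>b. f (a0 + h) b - f a0 b" "\<lambda>b. f\<^sub>b (a0 + h) b - f\<^sub>b a0 b"] h
    by (force intro!: DERIV_diff fb)
  obtain \<xi>' where \<xi>': "a0 < \<xi>'" "\<xi>' < a0 + h"
    "f\<^sub>b (a0 + h) \<eta>' - f\<^sub>b a0 \<eta>' = (a0 + h - a0) * f\<^sub>b\<^sub>a \<xi>' \<eta>'"
    using MVT2[of a0 "a0 + h" "\<lambda>a. f\<^sub>b a \<eta>'" "\<lambda>a. f\<^sub>b\<^sub>a a \<eta>'"] h \<eta>' by (force intro!: fba)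
  have "h * (h * f\<^sub>a\<^sub>b \<xi> \<eta>) = h * (h * f\<^sub>b\<^sub>a \<xi>' \<eta>')"
    using \<xi>(3) \<eta>(3) \<eta>'(3) \<xi>'(3) by (simp add: algebra_simps)
  hence "f\<^sub>a\<^sub>b \<xi> \<eta> = f\<^sub>b\<^sub>a \<xi>' \<eta>'" using h by simp
  moreover have "\<bar>f\<^sub>a\<^sub>b \<xi> \<eta> - f\<^sub>a\<^sub>b a0 b0\<bar> < e"
    using near \<xi> \<eta> d1 by blast
  moreover have "\<bar>f\<^sub>b\<^sub>a \<xi>' \<eta>' - f\<^sub>b\<^sub>a a0 b0\<bar> < e"
    using near \<xi>' \<eta>' d2 by blast
  ultimately show False by (simp add: e_def abs_if split: if_splits)
qed

section \<open>Calculus of C^m functions on a relatively open subset of a slice\<close>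

lemma continuous_on_two_coordinates:
  fixes z :: point
  shows "continuous_on A (\<lambda>p. z(i := fst p, j := snd p))"
proof (rule continuous_on_coordinatewise_then_product)
  fix l
  show "continuous_on A (\<lambda>p. (z(i := fst p, j := snd p)) l)"
    by (cases "l = j"; cases "l = i")
       (simp_all add: continuous_on_fst continuous_on_snd continuous_on_id)
qed

locale open_slice =
  fixes N :: nat and S :: "point set"
  assumes open_S: "openin (top_of_set (slice N)) S"
begin

text \<open>Regularity is graded by an order, so that closure properties follow by induction, each
  derivative costing one order. Only directions i \<le> N occur, because motion along them stays in
  the slice.\<close>

primrec cont_diff :: "nat \<Rightarrow> (point \<Rightarrow> real) \<Rightarrow> bool" where
  "cont_diff 0 f = continuous_on S f"
| "cont_diff (Suc m) f = (continuous_on S f \<and>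
     (\<forall>i\<le>N. (\<forall>z\<in>S. (\<lambda>s. f (z(i := s))) differentiable (at (z i))) \<and> cont_diff m (pderiv_at i f)))"

text \<open>Changing coordinates of index at most \<open>N\<close> never leaves the slice, so
  relative openness of \<open>S\<close> pulls back to genuine openness in the plane.\<close>

lemma open_plane_section:
  assumes "z \<in> S" "i \<le> N" "j \<le> N"
  shows "open {(a, b). z(i := a, j := b) \<in> S}"
proof -
  obtain T where T: "open T" "S = slice N \<inter> T"
    using open_S by (auto simp: openin_open)
  have "continuous_on UNIV (\<lambda>p::real \<times> real. z(i := fst p, j := snd p))"
    by (rule continuous_on_two_coordinates)
  hence "open ((\<lambda>p::real \<times> real. z(i := fst p, j := snd p)) -` T)"
    using T(1) by (simp add: continuous_on_open_vimage)
  moreover have "z(i := a, j := b) \<in> slice N" for a b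
    using assms T by (auto simp: slice_def)
  hence "{(a, b). z(i := a, j := b) \<in> S} = (\<lambda>p::real \<times> real. z(i := fst p, j := snd p)) -` T"
    using T(2) by auto
  ultimately show ?thesis by simp
qed

lemma eventually_line:
  assumes "z \<in> S" "i \<le> N"
  shows "eventually (\<lambda>s. z(i := s) \<in> S) (nhds (z i))"
proof -
  \<comment> \<open>With both directions equal to \<open>i\<close> the second update overrides the
    first, so the diagonal of the plane section is the line section.\<close>
  have "open ((\<lambda>s. (s, s)) -` {(a, b). z(i := a, i := b) \<in> S})"
    using open_plane_section[OF assms assms(2)]
    by (rule continuous_open_vimage) (intro continuous_intros)
  moreover have "(\<lambda>s. (s, s)) -` {(a, b). z(i := a, i := b) \<in> S} = {s. z(i := s) \<in> S}"
    by auto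
  ultimately show ?thesis
    using assms by (auto simp: eventually_nhds intro!: exI[of _ "{s. z(i := s) \<in> S}"])
qed

text \<open>A derivative in direction \<open>i\<close> only sees a short segment through
  \<open>z\<close>, and by openness that segment lies in \<open>S\<close>. Values outside
  \<open>S\<close> are therefore irrelevant.\<close>

lemma pderiv_at_cong:
  assumes "\<And>w. w \<in> S \<Longrightarrow> f w = g w" "z \<in> S" "i \<le> N"
  shows "pderiv_at i f z = pderiv_at i g z"
  unfolding pderiv_at_def
  by (rule deriv_cong_ev[OF eventually_mono[OF eventually_line]]) (use assms in auto)

lemma has_pderiv:
  assumes "cont_diff (Suc m) f" "z \<in> S" "i \<le> N"
  shows "((\<lambda>s. f (z(i := s))) has_real_derivative pderiv_at i f z) (at (z i))"
  using assms unfolding pderiv_at_def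
  by (auto simp: DERIV_deriv_iff_real_differentiable)

lemma has_pderiv_cong:
  assumes "((\<lambda>s. f (z(i := s))) has_real_derivative d) (at (z i))"
    and "\<And>w. w \<in> S \<Longrightarrow> f w = g w" "z \<in> S" "i \<le> N"
  shows "((\<lambda>s. g (z(i := s))) has_real_derivative d) (at (z i))"
proof -
  have "eventually (\<lambda>s. f (z(i := s)) = g (z(i := s))) (nhds (z i))"
    using eventually_line[OF assms(3,4)] by eventually_elim (rule assms(2))
  from DERIV_cong_ev[OF refl this refl] show ?thesis using assms(1) by blast
qed

lemma has_pderiv_add:
  assumes "cont_diff (Suc m) f" "cont_diff (Suc m) g" "z \<in> S" "i \<le> N"
  shows "((\<lambda>s. f (z(i := s)) + g (z(i := s))) has_real_derivative
           pderiv_at i f z + pderiv_at i g z) (at (z i))"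
  using has_pderiv[OF assms(1,3,4)] has_pderiv[OF assms(2,3,4)] by (rule DERIV_add)

lemma has_pderiv_mult:
  assumes "cont_diff (Suc m) f" "cont_diff (Suc m) g" "z \<in> S" "i \<le> N"
  shows "((\<lambda>s. f (z(i := s)) * g (z(i := s))) has_real_derivative
           pderiv_at i f z * g z + f z * pderiv_at i g z) (at (z i))"
  using DERIV_mult'[OF has_pderiv[OF assms(1,3,4)] has_pderiv[OF assms(2,3,4)]]
  by (simp only: fun_upd_triv add.commute)

lemma cont_diff_continuous: "cont_diff m f \<Longrightarrow> continuous_on S f"
  by (cases m) auto

lemma cont_diff_SucI:
  assumes "continuous_on S f"
    and "\<And>z i. z \<in> S \<Longrightarrow> i \<le> N \<Longrightarrow> ((\<lambda>s. f (z(i := s))) has_real_derivative f' i z) (at (z i))"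
    and "\<And>i. i \<le> N \<Longrightarrow> cont_diff m (pderiv_at i f)"
  shows "cont_diff (Suc m) f"
  using assms by (auto simp: real_differentiable_def)

lemma cont_diff_cong:
  "cont_diff m f \<Longrightarrow> (\<And>w. w \<in> S \<Longrightarrow> f w = g w) \<Longrightarrow> cont_diff m g"
proof (induction m arbitrary: f g)
  case 0
  then show ?case by (simp cong: continuous_on_cong)
next
  case (Suc m)
  show ?case
  proof (rule cont_diff_SucI)
    show "continuous_on S g"
      using cont_diff_continuous[OF Suc.prems(1)] Suc.prems(2) by (simp cong: continuous_on_cong)
    show "((\<lambda>s. g (z(i := s))) has_real_derivative pderiv_at i f z) (at (z i))"
      if "z \<in> S" "i \<le> N" for z i
      using has_pderiv_cong has_pderiv Suc.prems that by blast
    show "cont_diff m (pderiv_at i g)" if "i \<le> N" for i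
    proof (rule Suc.IH)
      show "cont_diff m (pderiv_at i f)" using Suc.prems(1) that by simp
      show "pderiv_at i f w = pderiv_at i g w" if "w \<in> S" for w
        using pderiv_at_cong[OF Suc.prems(2) that \<open>i \<le> N\<close>] .
    qed
  qed
qed

text \<open>Lets inductions use an explicit formula for the derivative: \<open>pderiv_at i f\<close>
  is known to equal \<open>f' i\<close> only on \<open>S\<close>, and \<open>cont_diff_cong\<close>
  makes that enough.\<close>

lemma cont_diff_Suc_pderivI:
  assumes "continuous_on S f"
    and d: "\<And>z i. z \<in> S \<Longrightarrow> i \<le> N \<Longrightarrow> ((\<lambda>s. f (z(i := s))) has_real_derivative f' i z) (at (z i))"
    and "\<And>i. i \<le> N \<Longrightarrow> cont_diff m (f' i)"
  shows "cont_diff (Suc m) f"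
proof (rule cont_diff_SucI[OF assms(1) d])
  show "cont_diff m (pderiv_at i f)" if "i \<le> N" for i
    by (rule cont_diff_cong[OF assms(3)[OF that]])
       (use d that in \<open>auto simp: pderiv_at_def intro!: DERIV_imp_deriv[symmetric]\<close>)
qed auto

lemma cont_diff_mono: "cont_diff (Suc m) f \<Longrightarrow> cont_diff m f"
proof (induction m arbitrary: f)
  case (Suc m)
  show ?case
  proof (rule cont_diff_Suc_pderivI)
    show "cont_diff m (pderiv_at i f)" if "i \<le> N" for i
      using Suc that by auto
    show "((\<lambda>s. f (z(i := s))) has_real_derivative pderiv_at i f z) (at (z i))"
      if "z \<in> S" "i \<le> N" for z i
      using has_pderiv[OF Suc.prems] that .
  qed (use Suc.prems in auto)
qed auto

lemma cont_diff_const: "cont_diff m (\<lambda>z. c)"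
proof (induction m arbitrary: c)
  case (Suc m)
  show ?case by (rule cont_diff_Suc_pderivI[where f' = "\<lambda>_ _. 0"]) (use Suc in auto)
qed simp

lemma cont_diff_coordinate: "cont_diff m (\<lambda>z. z n)"
proof -
  have c: "continuous_on S (\<lambda>z. z n)"
    by (rule continuous_on_subset[OF continuous_on_product_coordinates subset_UNIV])
  show ?thesis
  proof (cases m)
    case (Suc k)
    show ?thesis unfolding Suc
      by (rule cont_diff_Suc_pderivI[where f' = "\<lambda>i _. if i = n then 1 else 0"])
         (use c in \<open>auto intro: cont_diff_const\<close>)
  qed (use c in auto)
qed

lemma cont_diff_add:
  "cont_diff m f \<Longrightarrow> cont_diff m g \<Longrightarrow> cont_diff m (\<lambda>z. f z + g z)"
proof (induction m arbitrary: f g)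
  case (Suc m)
  show ?case
  proof (rule cont_diff_Suc_pderivI)
    show "cont_diff m (\<lambda>z. pderiv_at i f z + pderiv_at i g z)" if "i \<le> N" for i
      using Suc that by auto
    show "((\<lambda>s. f (z(i := s)) + g (z(i := s))) has_real_derivative
      pderiv_at i f z + pderiv_at i g z) (at (z i))" if "z \<in> S" "i \<le> N" for z i
      using has_pderiv_add[OF Suc.prems that] .
  qed (use Suc.prems in \<open>auto intro!: continuous_on_add\<close>)
qed (auto intro: continuous_on_add)

lemma cont_diff_mult:
  "cont_diff m f \<Longrightarrow> cont_diff m g \<Longrightarrow> cont_diff m (\<lambda>z. f z * g z)"
proof (induction m arbitrary: f g)
  case (Suc m)
  show ?case
  proof (rule cont_diff_Suc_pderivI)
    \<comment> \<open>The product rule contains \<open>f\<close> and \<open>g\<close> themselves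
      next to their derivatives, so their order is first lowered by \<open>cont_diff_mono\<close> to
      match.\<close>
    show "cont_diff m (\<lambda>z. pderiv_at i f z * g z + f z * pderiv_at i g z)" if "i \<le> N" for i
      using Suc.IH Suc.prems cont_diff_mono that by (intro cont_diff_add) auto
    show "((\<lambda>s. f (z(i := s)) * g (z(i := s))) has_real_derivative
      pderiv_at i f z * g z + f z * pderiv_at i g z) (at (z i))" if "z \<in> S" "i \<le> N" for z i
      using has_pderiv_mult[OF Suc.prems that] .
  qed (use Suc.prems in \<open>auto intro!: continuous_on_mult\<close>)
qed (auto intro: continuous_on_mult)

lemma cont_diff_uminus: "cont_diff m f \<Longrightarrow> cont_diff m (\<lambda>z. - f z)"
  using cont_diff_mult[OF cont_diff_const[of m "-1"]] by simp

lemma cont_diff_sum: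
  assumes "\<And>a. a \<in> A \<Longrightarrow> cont_diff m (f a)"
  shows "cont_diff m (\<lambda>z. \<Sum>a\<in>A. f a z)"
  using assms by (induction A rule: infinite_finite_induct) (auto intro: cont_diff_const cont_diff_add)

lemma pderiv_at_add:
  assumes "cont_diff 1 f" "cont_diff 1 g" "z \<in> S" "i \<le> N"
  shows "pderiv_at i (\<lambda>z. f z + g z) z = pderiv_at i f z + pderiv_at i g z"
  using DERIV_imp_deriv[OF has_pderiv_add[of 0 f g z i]] assms
  by (simp only: One_nat_def pderiv_at_def)

lemma pderiv_at_mult:
  assumes "cont_diff 1 f" "cont_diff 1 g" "z \<in> S" "i \<le> N"
  shows "pderiv_at i (\<lambda>z. f z * g z) z = pderiv_at i f z * g z + f z * pderiv_at i g z"
  using DERIV_imp_deriv[OF has_pderiv_mult[of 0 f g z i]] assms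
  by (simp only: One_nat_def pderiv_at_def)

lemma pderiv_at_const [simp]: "pderiv_at i (\<lambda>z. c) z = 0"
  by (simp add: pderiv_at_def)

lemma pderiv_at_cmult:
  assumes "cont_diff 1 f" "z \<in> S" "i \<le> N"
  shows "pderiv_at i (\<lambda>z. c * f z) z = c * pderiv_at i f z"
  using pderiv_at_mult[OF cont_diff_const assms, of c] by simp

lemma pderiv_at_sum:
  assumes "\<And>a. a \<in> A \<Longrightarrow> cont_diff 1 (f a)" "z \<in> S" "i \<le> N"
  shows "pderiv_at i (\<lambda>z. \<Sum>a\<in>A. f a z) z = (\<Sum>a\<in>A. pderiv_at i (f a) z)"
  using assms
proof (induction A rule: infinite_finite_induct)
  case (insert a A)
  then show ?case
    using pderiv_at_add[of "f a" "\<lambda>z. \<Sum>a\<in>A. f a z"] cont_diff_sum[of A 1 f] by simp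
qed auto

text \<open>Freezing all coordinates except \<open>i\<close> and \<open>j\<close> reduces this to
  two real variables; order 2 supplies the continuous mixed partials.\<close>

lemma pderiv_at_commute:
  assumes f: "cont_diff 2 f" and z: "z \<in> S" and ij: "i \<le> N" "j \<le> N"
  shows "pderiv_at i (pderiv_at j f) z = pderiv_at j (pderiv_at i f) z"
proof (cases "i = j")
  case False
  note f2 = f[unfolded numeral_2_eq_2]
  define w where "w a b = z(i := a, j := b)" for a b
  define R where "R = {(a, b). w a b \<in> S}"
  have w: "w (z i) (z j) = z" by (auto simp: w_def)
  have R: "open R" using open_plane_section[OF z ij] by (simp add: R_def w_def)
  have zR: "(z i, z j) \<in> R" using z w by (simp add: R_def)
  then obtain r where r: "r > 0" "ball (z i, z j) r \<subseteq> R" using R openE by blast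
  \<comment> \<open>Half the radius in each coordinate suffices, since the Euclidean distance is at
    most the sum of the coordinate distances.\<close>
  have box: "w a b \<in> S" if "\<bar>a - z i\<bar> < r / 2" "\<bar>b - z j\<bar> < r / 2" for a b
  proof -
    have "dist (a, b) (z i, z j) \<le> \<bar>a - z i\<bar> + \<bar>b - z j\<bar>"
      by (simp add: dist_Pair_Pair dist_real_def sqrt_sum_squares_le_sum_abs)
    hence "dist (a, b) (z i, z j) < r" using that by simp
    thus ?thesis using r(2) by (auto simp: R_def dist_commute subset_iff)
  qed
  have wi: "(w a b)(i := s) = w s b" "w a b i = a" and wj: "(w a b)(j := s) = w a s" "w a b j = b"
    for a b s using False by (auto simp: w_def)
  have cont: "isCont (\<lambda>(a, b). g (w a b)) (z i, z j)" if "continuous_on S g" for g :: "point \<Rightarrow> real"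
  proof -
    have "continuous_on R (\<lambda>p. w (fst p) (snd p))"
      unfolding w_def by (rule continuous_on_two_coordinates)
    moreover have "(\<lambda>p. w (fst p) (snd p)) ` R \<subseteq> S" by (auto simp: R_def)
    ultimately have "continuous_on R (\<lambda>p. g (w (fst p) (snd p)))"
      using continuous_on_compose2[OF that] by blast
    thus ?thesis using R zR by (simp add: continuous_on_eq_continuous_at case_prod_unfold)
  qed
  have cd: "cont_diff (Suc 0) (pderiv_at i f)" "cont_diff (Suc 0) (pderiv_at j f)"
    "continuous_on S (pderiv_at i (pderiv_at j f))" "continuous_on S (pderiv_at j (pderiv_at i f))"
    using f2 ij by auto
  have "pderiv_at j (pderiv_at i f) (w (z i) (z j)) = pderiv_at i (pderiv_at j f) (w (z i) (z j))"
  proof (rule mixed_partials_eq[where r = "r / 2" and f = "\<lambda>a b. f (w a b)" and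
          f\<^sub>a = "\<lambda>a b. pderiv_at i f (w a b)" and f\<^sub>b = "\<lambda>a b. pderiv_at j f (w a b)" and
          f\<^sub>a\<^sub>b = "\<lambda>a b. pderiv_at j (pderiv_at i f) (w a b)" and
          f\<^sub>b\<^sub>a = "\<lambda>a b. pderiv_at i (pderiv_at j f) (w a b)" and ?a0.0 = "z i" and ?b0.0 = "z j"])
    fix a b :: real assume "\<bar>a - z i\<bar> < r / 2" "\<bar>b - z j\<bar> < r / 2"
    hence S: "w a b \<in> S" by (rule box)
    show "((\<lambda>s. f (w s b)) has_real_derivative pderiv_at i f (w a b)) (at a)"
      using has_pderiv[OF f2 S ij(1)] by (simp add: wi)
    show "((\<lambda>s. f (w a s)) has_real_derivative pderiv_at j f (w a b)) (at b)"
      using has_pderiv[OF f2 S ij(2)] by (simp add: wj)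
    show "((\<lambda>s. pderiv_at i f (w a s)) has_real_derivative pderiv_at j (pderiv_at i f) (w a b)) (at b)"
      using has_pderiv[OF cd(1) S ij(2)] by (simp add: wj)
    show "((\<lambda>s. pderiv_at j f (w s b)) has_real_derivative pderiv_at i (pderiv_at j f) (w a b)) (at a)"
      using has_pderiv[OF cd(2) S ij(1)] by (simp add: wi)
  qed (use r cont cd in auto)
  thus ?thesis by (simp add: w)
qed auto

end

section \<open>From smoothness on the inductive limit to C^m on each slice\<close>

lemma smooth_inD:
  assumes "smooth_in D f"
  shows "continuous_on (D \<inter> slice N) f"
    and "\<forall>z\<in>D. \<forall>i. (\<lambda>s. f (z(i := s))) differentiable at (z i)"
  using spec[OF assms[unfolded smooth_in_def], of "[]"] by (auto simp: pderivs_def)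

text \<open>Smoothness passes to partial derivatives because a further direction can be appended as
  the innermost entry of the list in \<open>pderivs\<close>; induction on the order then
  applies.\<close>

lemma smooth_in_imp_cont_diff:
  assumes "open_domain D" "smooth_in D f"
  shows "open_slice.cont_diff N (D \<inter> slice N) m f"
proof -
  interpret open_slice N "D \<inter> slice N"
    by standard (use assms(1) in \<open>auto simp: open_domain_def\<close>)
  show ?thesis using assms(2)
  proof (induction m arbitrary: f)
    case 0
    thus ?case using smooth_inD by simp
  next
    case (Suc m)
    have "smooth_in D (pderiv_at i f)" for i
      unfolding smooth_in_def
    proof
      fix ks :: "nat list"
      have "pderivs ks (pderiv_at i f) = pderivs (ks @ [i]) f" by (simp add: pderivs_def)
      thus "(\<forall>N. continuous_on (D \<inter> slice N) (pderivs ks (pderiv_at i f))) \<and>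
        (\<forall>z\<in>D. \<forall>ia. (\<lambda>s. pderivs ks (pderiv_at i f) (z(ia := s))) differentiable at (z ia))"
        using Suc.prems by (simp add: smooth_in_def)
    qed
    moreover have "continuous_on (D \<inter> slice N) f"
      "\<forall>z\<in>D. \<forall>i. (\<lambda>s. f (z(i := s))) differentiable at (z i)"
      using Suc.prems smooth_inD by simp_all
    ultimately show ?case using Suc.IH by auto
  qed
qed

section \<open>Laurent series with differentiable coefficients\<close>

text \<open>A lower bound on the exponents is used in place of \<open>fls_subdegree\<close>: it can
  be common to all points, is stable under sums, and needs no exception for the zero series.\<close>

definition vanishes_below :: "int \<Rightarrow> 'a::zero fls \<Rightarrow> bool" where
  "vanishes_below a f \<longleftrightarrow> (\<forall>k<a. f $$ k = 0)"

lemma vanishes_belowD: "vanishes_below a f \<Longrightarrow> k < a \<Longrightarrow> f $$ k = 0"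
  by (simp add: vanishes_below_def)

lemma vanishes_below_mono: "vanishes_below a f \<Longrightarrow> b \<le> a \<Longrightarrow> vanishes_below b f"
  by (auto simp: vanishes_below_def)

text \<open>Enlarging the range given by the subdegrees only adds zero terms. The resulting range
  depends on the bounds alone, so it stays fixed while the point varies.\<close>

lemma fls_mult_nth_vanishes_below:
  fixes f g :: "'a::semiring_0 fls"
  assumes "vanishes_below a f" "vanishes_below b g"
  shows "(f * g) $$ n = (\<Sum>i=a..n-b. f $$ i * g $$ (n - i))"
proof (cases "f = 0 \<or> g = 0")
  case False
  have "a \<le> fls_subdegree f" "b \<le> fls_subdegree g"
    using False assms by (auto intro!: fls_subdegree_geI simp: vanishes_below_def)
  hence "(\<Sum>i=fls_subdegree f..n - fls_subdegree g. f $$ i * g $$ (n - i))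
      = (\<Sum>i=a..n-b. f $$ i * g $$ (n - i))"
    by (intro sum.mono_neutral_left) (auto simp: not_le)
  thus ?thesis by (simp add: fls_times_nth(2))
qed auto

lemma vanishes_below_mult:
  fixes f g :: "'a::semiring_0 fls"
  assumes "vanishes_below a f" "vanishes_below b g"
  shows "vanishes_below (a + b) (f * g)"
  by (simp add: vanishes_below_def fls_mult_nth_vanishes_below[OF assms])

lemma vanishes_below_diff:
  fixes f g :: "'a::group_add fls"
  shows "vanishes_below a f \<Longrightarrow> vanishes_below a g \<Longrightarrow> vanishes_below a (f - g)"
  by (simp add: vanishes_below_def)

lemma vanishes_below_const: "vanishes_below 0 (fls_const c)"
  by (simp add: vanishes_below_def)

lemma vanishes_below_power:
  fixes f :: "'a::comm_semiring_1 fls"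
  assumes "vanishes_below 1 f"
  shows "vanishes_below (int n) (f ^ n)"
proof (induction n)
  case (Suc n)
  show ?case using vanishes_below_mult[OF assms Suc] by (simp add: add.commute)
qed (simp add: vanishes_below_def)

lemma dist_fls_le:
  fixes a b :: "'a::group_add fls"
  assumes "vanishes_below (int d) (a - b)"
  shows "dist a b \<le> (1 / 2) ^ d"
proof (cases "a = b")
  case False
  hence *: "int d \<le> fls_subdegree (a - b)"
    using assms by (intro fls_subdegree_geI) (auto simp: vanishes_below_def)
  hence "dist a b = (1 / 2) ^ nat (fls_subdegree (a - b))"
    using False by (simp add: dist_fls_def power_one_over inverse_eq_divide)
  also have "\<dots> \<le> (1 / 2) ^ d"
    using * by (intro power_decreasing) auto
  finally show ?thesis .
qed simp

text \<open>Term \<open>n\<close> starts at exponent n + 1, so only the terms with n < k reach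
  coefficient \<open>k\<close>. The series with these coefficients is within 2^(-m) of the m-th
  partial sum, hence is the limit.\<close>

lemma suminf_fls_nth:
  fixes f :: "nat \<Rightarrow> 'a::ab_group_add fls"
  assumes f: "\<And>n. vanishes_below (int (Suc n)) (f n)"
  shows "(\<Sum>n. f n) $$ k = (\<Sum>n<nat k. f n $$ k)"
proof -
  \<comment> \<open>For k \<le> 0 the value \<open>nat k = 0\<close> makes the sum empty, which
    provides the lower bound needed by \<open>Abs_fls\<close>.\<close>
  define s where "s = Abs_fls (\<lambda>k. \<Sum>n<nat k. f n $$ k)"
  have s_nth: "s $$ k = (\<Sum>n<nat k. f n $$ k)" for k
    unfolding s_def by (rule nth_Abs_fls_lower_bound[of 0]) auto
  have sum_nth: "(\<Sum>n<m. f n) $$ k = (\<Sum>n<m. f n $$ k)" for m k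
    by (induction m) auto
  have "vanishes_below (int m) ((\<Sum>n<m. f n) - s)" for m
    unfolding vanishes_below_def
  proof (intro allI impI)
    fix k assume k: "k < int m"
    have "(\<Sum>n<nat k. f n $$ k) = (\<Sum>n<m. f n $$ k)"
      using k by (intro sum.mono_neutral_left) (auto intro!: vanishes_belowD[OF f])
    thus "((\<Sum>n<m. f n) - s) $$ k = 0" by (simp add: s_nth sum_nth)
  qed
  hence le: "dist (\<Sum>n<m. f n) s \<le> (1 / 2) ^ m" for m
    by (rule dist_fls_le)
  have "(\<lambda>m. dist (\<Sum>n<m. f n) s) \<longlonglongrightarrow> 0"
  proof (rule tendsto_sandwich[where f = "\<lambda>_. 0" and h = "\<lambda>m. (1 / 2) ^ m"])
    show "(\<lambda>m. (1 / 2 :: real) ^ m) \<longlonglongrightarrow> 0" by (rule LIMSEQ_power_zero) simp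
    show "\<forall>\<^sub>F m in sequentially. 0 \<le> dist (\<Sum>n<m. f n) s" by simp
    show "\<forall>\<^sub>F m in sequentially. dist (\<Sum>n<m. f n) s \<le> (1 / 2) ^ m"
      by (rule always_eventually) (use le in blast)
  qed (rule tendsto_const)
  hence "f sums s"
    unfolding sums_def by (rule tendsto_dist_iff[THEN iffD2])
  thus ?thesis using s_nth sums_unique by metis
qed

section \<open>The derivative in p\<close>

lemma Dp_nth: "Dp F z $$ k = of_int (1 - k) * F z $$ (k - 1)"
proof -
  have "fls_X ^ 2 * fls_deriv (F z) = fls_shift (-2) (fls_deriv (F z))"
    by (simp add: fls_X_power_times_conv_shift(1))
  thus ?thesis by (simp add: Dp_def algebra_simps)
qed

lemma Dp_cong: "F z = G z \<Longrightarrow> Dp F z = Dp G z"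
  by (simp add: Dp_def)

lemma Dp_const [simp]: "Dp (\<lambda>w. fls_const (f w)) z = 0"
  by (simp add: Dp_def)

lemma Dp_add: "Dp (\<lambda>w. F w + G w) z = Dp F z + Dp G z"
  and Dp_diff: "Dp (\<lambda>w. F w - G w) z = Dp F z - Dp G z"
  and Dp_mult: "Dp (\<lambda>w. F w * G w) z = Dp F z * G z + F z * Dp G z"
  by (simp_all add: Dp_def algebra_simps)

lemma Dp_sum: "Dp (\<lambda>w. \<Sum>a\<in>A. F a w) z = (\<Sum>a\<in>A. Dp (F a) z)"
  by (induction A rule: infinite_finite_induct) (simp_all add: Dp_def algebra_simps)

lemma vanishes_below_Dp: "vanishes_below a (F z) \<Longrightarrow> vanishes_below (a + 1) (Dp F z)"
  by (simp add: vanishes_below_def Dp_nth)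

lemma poly_part_nth [simp]: "poly_part f $$ k = (if k \<le> 0 then f $$ k else 0)"
  by transfer auto

section \<open>Closure properties of series with C^m coefficients\<close>

context open_slice
begin

text \<open>The lower bound is uniform on \<open>S\<close>, so that each coefficient of a product is
  one finite sum with the same range at every point.\<close>

definition cont_diff_series :: "nat \<Rightarrow> series \<Rightarrow> bool" where
  "cont_diff_series m F \<longleftrightarrow>
     (\<exists>a. \<forall>z\<in>S. vanishes_below a (F z)) \<and> (\<forall>k. cont_diff m (\<lambda>z. F z $$ k))"

lemma cont_diff_series_vanishes_below:
  assumes "cont_diff_series m F"
  obtains a where "\<And>z. z \<in> S \<Longrightarrow> vanishes_below a (F z)"
  using assms unfolding cont_diff_series_def by blast

lemma cont_diff_series_nth: "cont_diff_series m F \<Longrightarrow> cont_diff m (\<lambda>z. F z $$ k)"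
  by (simp add: cont_diff_series_def)

lemma cont_diff_series_cong:
  assumes "cont_diff_series m F" "\<And>z. z \<in> S \<Longrightarrow> F z = G z"
  shows "cont_diff_series m G"
  unfolding cont_diff_series_def
proof
  show "\<exists>a. \<forall>z\<in>S. vanishes_below a (G z)"
    using assms by (auto simp: cont_diff_series_def)
  show "\<forall>k. cont_diff m (\<lambda>z. G z $$ k)"
  proof
    fix k
    show "cont_diff m (\<lambda>z. G z $$ k)"
      using assms(1) by (rule_tac cont_diff_cong[of m "\<lambda>z. F z $$ k"])
        (auto simp: cont_diff_series_def assms(2))
  qed
qed

lemma cont_diff_series_const:
  assumes "cont_diff m f"
  shows "cont_diff_series m (\<lambda>z. fls_const (f z))"
  unfolding cont_diff_series_def
proof
  show "\<exists>a. \<forall>z\<in>S. vanishes_below a (fls_const (f z))"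
    using vanishes_below_const by blast
  show "\<forall>k. cont_diff m (\<lambda>z. fls_const (f z) $$ k)"
  proof
    fix k :: int
    show "cont_diff m (\<lambda>z. fls_const (f z) $$ k)"
      by (cases "k = 0") (simp_all add: assms cont_diff_const)
  qed
qed

lemma cont_diff_series_1: "cont_diff_series m (\<lambda>z. 1)"
  using cont_diff_series_const[OF cont_diff_const[of m 1]] by simp

lemma cont_diff_series_0: "cont_diff_series m (\<lambda>z. 0)"
  using cont_diff_series_const[OF cont_diff_const[of m 0]] by simp

lemma cont_diff_series_add:
  assumes "cont_diff_series m F" "cont_diff_series m G"
  shows "cont_diff_series m (\<lambda>z. F z + G z)"
proof -
  obtain a b where "\<forall>z\<in>S. vanishes_below a (F z)" "\<forall>z\<in>S. vanishes_below b (G z)"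
    using assms by (auto simp: cont_diff_series_def)
  hence "\<forall>z\<in>S. vanishes_below (min a b) (F z + G z)"
    by (simp add: vanishes_below_def)
  thus ?thesis using assms by (auto simp: cont_diff_series_def intro!: cont_diff_add)
qed

lemma cont_diff_series_mult:
  assumes "cont_diff_series m F" "cont_diff_series m G"
  shows "cont_diff_series m (\<lambda>z. F z * G z)"
proof -
  obtain a b where ab: "\<forall>z\<in>S. vanishes_below a (F z)" "\<forall>z\<in>S. vanishes_below b (G z)"
    using assms by (auto simp: cont_diff_series_def)
  have "cont_diff m (\<lambda>z. (F z * G z) $$ k)" for k
  proof (rule cont_diff_cong)
    show "cont_diff m (\<lambda>z. \<Sum>i=a..k-b. F z $$ i * G z $$ (k - i))"
      using assms by (intro cont_diff_sum cont_diff_mult) (auto simp: cont_diff_series_def)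
  qed (use ab fls_mult_nth_vanishes_below in metis)
  thus ?thesis using ab vanishes_below_mult unfolding cont_diff_series_def by blast
qed

lemma cont_diff_series_uminus:
  assumes "cont_diff_series m F"
  shows "cont_diff_series m (\<lambda>z. - F z)"
  using assms unfolding cont_diff_series_def
  by (auto simp: vanishes_below_def intro!: cont_diff_uminus)

lemma cont_diff_series_diff:
  assumes "cont_diff_series m F" "cont_diff_series m G"
  shows "cont_diff_series m (\<lambda>z. F z - G z)"
  using cont_diff_series_add[OF assms(1) cont_diff_series_uminus[OF assms(2)]] by simp

lemma cont_diff_series_power:
  "cont_diff_series m F \<Longrightarrow> cont_diff_series m (\<lambda>z. F z ^ n)"
  by (induction n) (simp_all add: cont_diff_series_1 cont_diff_series_mult)

lemma cont_diff_series_sum: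
  "(\<And>a. a \<in> A \<Longrightarrow> cont_diff_series m (F a)) \<Longrightarrow> cont_diff_series m (\<lambda>z. \<Sum>a\<in>A. F a z)"
  by (induction A rule: infinite_finite_induct)
     (simp_all add: cont_diff_series_0 cont_diff_series_add)

lemma cont_diff_series_poly_part:
  assumes "cont_diff_series m F"
  shows "cont_diff_series m (\<lambda>z. poly_part (F z))"
  unfolding cont_diff_series_def
proof
  show "\<exists>a. \<forall>z\<in>S. vanishes_below a (poly_part (F z))"
    using assms by (auto simp: cont_diff_series_def vanishes_below_def)
  show "\<forall>k. cont_diff m (\<lambda>z. poly_part (F z) $$ k)"
  proof
    fix k
    show "cont_diff m (\<lambda>z. poly_part (F z) $$ k)"
      using assms by (cases "k \<le> 0") (simp_all add: cont_diff_series_def cont_diff_const)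
  qed
qed

lemma cont_diff_series_Dp:
  assumes "cont_diff_series m F"
  shows "cont_diff_series m (Dp F)"
proof -
  obtain a where "\<And>z. z \<in> S \<Longrightarrow> vanishes_below a (F z)"
    using assms cont_diff_series_vanishes_below by blast
  hence "\<forall>z\<in>S. vanishes_below (a + 1) (Dp F z)"
    using vanishes_below_Dp by blast
  moreover have "cont_diff m (\<lambda>z. Dp F z $$ k)" for k
    unfolding Dp_nth by (intro cont_diff_mult cont_diff_const cont_diff_series_nth assms)
  ultimately show ?thesis unfolding cont_diff_series_def by blast
qed

text \<open>Each coefficient of the infinite sum involves finitely many terms, their number
  depending only on the exponent. It serves both for \<open>Lax\<close>, with \<open>Y\<close> the
  variable X, and for the tail of \<open>Orlov\<close>, with \<open>Y\<close> the inverse of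
  \<open>Lax\<close>.\<close>

lemma cont_diff_series_power_sum:
  assumes "\<And>n. cont_diff m (c n)" "cont_diff_series m Y"
    and Y: "\<And>z. z \<in> S \<Longrightarrow> vanishes_below 1 (Y z)"
  shows "cont_diff_series m (\<lambda>z. \<Sum>n. fls_const (c n z) * Y z ^ Suc n)"
    and "z \<in> S \<Longrightarrow> vanishes_below 1 (\<Sum>n. fls_const (c n z) * Y z ^ Suc n)"
proof -
  have v: "vanishes_below (int (Suc n)) (fls_const (c n z) * Y z ^ Suc n)" if "z \<in> S" for z n
    using vanishes_below_mult[OF vanishes_below_const vanishes_below_power[OF Y[OF that]]]
    by (metis add_0)
  note nth = suminf_fls_nth[OF v]
  show 1: "vanishes_below 1 (\<Sum>n. fls_const (c n z) * Y z ^ Suc n)" if "z \<in> S" for z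
    unfolding vanishes_below_def using nth[OF that] by simp
  have "cont_diff m (\<lambda>z. (\<Sum>n. fls_const (c n z) * Y z ^ Suc n) $$ k)" for k
  proof (rule cont_diff_cong)
    show "cont_diff m (\<lambda>z. \<Sum>n<nat k. (fls_const (c n z) * Y z ^ Suc n) $$ k)"
    proof (rule cont_diff_sum)
      fix n
      have "cont_diff_series m (\<lambda>z. fls_const (c n z) * Y z ^ Suc n)"
        by (intro cont_diff_series_mult cont_diff_series_const cont_diff_series_power assms)
      thus "cont_diff m (\<lambda>z. (fls_const (c n z) * Y z ^ Suc n) $$ k)"
        by (simp add: cont_diff_series_def)
    qed
  qed (simp only: nth)
  thus "cont_diff_series m (\<lambda>z. \<Sum>n. fls_const (c n z) * Y z ^ Suc n)"
    using 1 unfolding cont_diff_series_def by blast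
qed

text \<open>With leading coefficient 1, comparing coefficients in F * G = 1 expresses each
  coefficient of the inverse as a polynomial in those of F and earlier ones of G, without
  division.\<close>

lemma cont_diff_series_inverse:
  assumes F: "cont_diff_series m F"
    and d: "\<And>z. z \<in> S \<Longrightarrow> vanishes_below d (F z)" "\<And>z. z \<in> S \<Longrightarrow> F z $$ d = 1"
  shows "cont_diff_series m (\<lambda>z. inverse (F z))"
    and "z \<in> S \<Longrightarrow> vanishes_below (- d) (inverse (F z))"
    and "z \<in> S \<Longrightarrow> F z * inverse (F z) = 1"
proof -
  define G where "G z = inverse (F z)" for z
  have sub: "fls_subdegree (F z) = d" if "z \<in> S" for z
    using d[OF that] by (intro fls_subdegree_eqI) (auto simp: vanishes_below_def)
  show vG: "vanishes_below (- d) (inverse (F z))" if "z \<in> S" for z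
    using sub[OF that] by (auto simp: vanishes_below_def)
  show FG: "F z * inverse (F z) = 1" if "z \<in> S" for z
    using d(2)[OF that] by (intro right_inverse) auto
  \<comment> \<open>The term i = d of the coefficient of X^n in F * G is exactly the newest unknown,
    at exponent n - d; all others are moved to the right.\<close>
  have rec: "G z $$ (int n - d) = (if n = 0 then 1 else 0)
      - (\<Sum>i=d+1..int n + d. F z $$ i * G z $$ (int n - i))" if "z \<in> S" for z n
  proof -
    have "(F z * G z) $$ int n = (\<Sum>i=d..int n + d. F z $$ i * G z $$ (int n - i))"
      using fls_mult_nth_vanishes_below[OF d(1)[OF that] vG[OF that]] by (simp add: G_def)
    also have "{d..int n + d} = insert d {d+1..int n + d}" by auto
    also have "(\<Sum>i\<in>\<dots>. F z $$ i * G z $$ (int n - i))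
        = G z $$ (int n - d) + (\<Sum>i=d+1..int n + d. F z $$ i * G z $$ (int n - i))"
      using d(2)[OF that] by simp
    finally show ?thesis using FG[OF that] by (simp add: G_def)
  qed
  have G: "cont_diff m (\<lambda>z. G z $$ (int n - d))" for n
  proof (induction n rule: less_induct)
    case (less n)
    have "cont_diff m (\<lambda>z. G z $$ (int n - i))" if "i \<in> {d+1..int n + d}" for i
    proof -
      \<comment> \<open>Here i \<ge> d + 1 makes the index strictly smaller than \<open>n\<close>,
        and i \<le> n + d keeps it non-negative, so \<open>nat\<close> is harmless.\<close>
      have "int n - i = int (nat (int n - i + d)) - d" "nat (int n - i + d) < n"
        using that by auto
      thus ?thesis using less by metis
    qed
    moreover have "cont_diff m (\<lambda>z. F z $$ i)" for i
      using F by (simp add: cont_diff_series_def)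
    ultimately have "cont_diff m (\<lambda>z. (if n = 0 then 1 else 0)
        + - (\<Sum>i=d+1..int n + d. F z $$ i * G z $$ (int n - i)))"
      by (intro cont_diff_add cont_diff_const cont_diff_uminus cont_diff_sum cont_diff_mult)
    thus ?case by (rule cont_diff_cong) (simp add: rec)
  qed
  have "cont_diff m (\<lambda>z. G z $$ k)" for k
  proof (cases "k < - d")
    case True
    show ?thesis
      by (rule cont_diff_cong[OF cont_diff_const[of m 0]])
         (use vanishes_belowD[OF vG True] in \<open>simp add: G_def\<close>)
  next
    case False
    thus ?thesis using G[of "nat (k + d)"] by simp
  qed
  thus "cont_diff_series m (\<lambda>z. inverse (F z))"
    using vG unfolding cont_diff_series_def G_def by blast
qed

section \<open>Coefficientwise derivatives of series in x and the times\<close>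

text \<open>\<open>Abs_fls\<close> returns the intended coefficients only if they vanish far enough
  below. The uniform bound ensures this: coefficients below it are zero throughout \<open>S\<close>,
  hence so are their derivatives.\<close>

lemma Dvar_nth:
  assumes "cont_diff_series m F" "z \<in> S" "i \<le> N"
  shows "Dvar i F z $$ k = pderiv_at i (\<lambda>w. F w $$ k) z"
proof -
  obtain a where a: "\<forall>z\<in>S. vanishes_below a (F z)"
    using assms by (auto simp: cont_diff_series_def)
  have "pderiv_at i (\<lambda>w. F w $$ k) z = 0" if "k < a" for k
    using pderiv_at_cong[of "\<lambda>w. F w $$ k" "\<lambda>w. 0" z i] a that assms
    by (auto simp: vanishes_below_def)
  thus ?thesis unfolding Dvar_def by (intro nth_Abs_fls_lower_bound[of a]) auto
qed

lemma vanishes_below_Dvar: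
  assumes "cont_diff_series m F" "z \<in> S" "i \<le> N" "\<And>w. w \<in> S \<Longrightarrow> vanishes_below a (F w)"
  shows "vanishes_below a (Dvar i F z)"
  unfolding vanishes_below_def
proof (intro allI impI)
  fix k assume "k < a"
  thus "Dvar i F z $$ k = 0"
    using pderiv_at_cong[of "\<lambda>w. F w $$ k" "\<lambda>w. 0" z i] assms
    by (auto simp: vanishes_below_def Dvar_nth)
qed

lemma cont_diff_series_Dvar:
  assumes "cont_diff_series (Suc m) F" "i \<le> N"
  shows "cont_diff_series m (Dvar i F)"
proof -
  obtain a where "\<forall>z\<in>S. vanishes_below a (F z)"
    using assms by (auto simp: cont_diff_series_def)
  hence "\<forall>z\<in>S. vanishes_below a (Dvar i F z)"
    using vanishes_below_Dvar assms by blast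
  moreover have "cont_diff m (\<lambda>z. Dvar i F z $$ k)" for k
  proof (rule cont_diff_cong)
    show "cont_diff m (pderiv_at i (\<lambda>w. F w $$ k))"
      using assms by (simp add: cont_diff_series_def)
  qed (use Dvar_nth assms in simp)
  ultimately show ?thesis unfolding cont_diff_series_def by blast
qed

lemma Dvar_cong:
  assumes "\<And>w. w \<in> S \<Longrightarrow> F w = G w" "z \<in> S" "i \<le> N"
  shows "Dvar i F z = Dvar i G z"
  unfolding Dvar_def
  by (intro arg_cong[where f = Abs_fls] ext pderiv_at_cong) (use assms in auto)

lemma Dvar_const [simp]: "Dvar i (\<lambda>w. c) z = 0"
  by (simp add: Dvar_def zero_fls_def)

lemma Dvar_fls_const:
  assumes "cont_diff m f" "z \<in> S" "i \<le> N"
  shows "Dvar i (\<lambda>w. fls_const (f w)) z = fls_const (pderiv_at i f z)"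
proof (rule fls_eqI)
  fix k :: int
  show "Dvar i (\<lambda>w. fls_const (f w)) z $$ k = fls_const (pderiv_at i f z) $$ k"
    unfolding Dvar_nth[OF cont_diff_series_const[OF assms(1)] assms(2,3)]
    by (cases "k = 0") simp_all
qed

lemma Dvar_add:
  assumes "cont_diff_series 1 F" "cont_diff_series 1 G" "z \<in> S" "i \<le> N"
  shows "Dvar i (\<lambda>w. F w + G w) z = Dvar i F z + Dvar i G z"
proof (rule fls_eqI)
  fix k
  show "Dvar i (\<lambda>w. F w + G w) z $$ k = (Dvar i F z + Dvar i G z) $$ k"
    using pderiv_at_add[OF assms(1,2)[THEN cont_diff_series_nth] assms(3,4)]
    by (simp add: Dvar_nth[OF cont_diff_series_add[OF assms(1,2)] assms(3,4)]
        Dvar_nth[OF assms(1,3,4)] Dvar_nth[OF assms(2,3,4)])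
qed

text \<open>The Leibniz rule is applied inside a finite sum of fixed range. Derivatives inherit the
  lower bounds of the series, so the same range reassembles both products.\<close>

lemma Dvar_mult:
  assumes F: "cont_diff_series 1 F" and G: "cont_diff_series 1 G" and z: "z \<in> S" and i: "i \<le> N"
  shows "Dvar i (\<lambda>w. F w * G w) z = Dvar i F z * G z + F z * Dvar i G z"
proof (rule fls_eqI)
  fix k
  obtain a b where a: "\<And>z. z \<in> S \<Longrightarrow> vanishes_below a (F z)"
    and b: "\<And>z. z \<in> S \<Longrightarrow> vanishes_below b (G z)"
    using F G cont_diff_series_vanishes_below by metis
  have cF: "cont_diff 1 (\<lambda>w. F w $$ l)" and cG: "cont_diff 1 (\<lambda>w. G w $$ l)" for l
    by (rule cont_diff_series_nth[OF F] cont_diff_series_nth[OF G])+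
  have "Dvar i (\<lambda>w. F w * G w) z $$ k = pderiv_at i (\<lambda>w. (F w * G w) $$ k) z"
    by (rule Dvar_nth[OF cont_diff_series_mult[OF F G] z i])
  also have "\<dots> = pderiv_at i (\<lambda>w. \<Sum>l=a..k-b. F w $$ l * G w $$ (k - l)) z"
    by (rule pderiv_at_cong[OF fls_mult_nth_vanishes_below[OF a b] z i])
  also have "\<dots> = (\<Sum>l=a..k-b. pderiv_at i (\<lambda>w. F w $$ l * G w $$ (k - l)) z)"
    by (rule pderiv_at_sum[OF cont_diff_mult[OF cF cG] z i])
  also have "\<dots> = (\<Sum>l=a..k-b. Dvar i F z $$ l * G z $$ (k - l) + F z $$ l * Dvar i G z $$ (k - l))"
    by (simp add: pderiv_at_mult[OF cF cG z i] Dvar_nth[OF F z i] Dvar_nth[OF G z i])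
  also have "\<dots> = (Dvar i F z * G z + F z * Dvar i G z) $$ k"
    using fls_mult_nth_vanishes_below[OF vanishes_below_Dvar[OF F z i a] b[OF z]]
      fls_mult_nth_vanishes_below[OF a[OF z] vanishes_below_Dvar[OF G z i b]]
    by (simp add: sum.distrib)
  finally show "Dvar i (\<lambda>w. F w * G w) z $$ k = (Dvar i F z * G z + F z * Dvar i G z) $$ k" .
qed

lemma Dvar_diff:
  assumes "cont_diff_series 1 F" "cont_diff_series 1 G" "z \<in> S" "i \<le> N"
  shows "Dvar i (\<lambda>w. F w - G w) z = Dvar i F z - Dvar i G z"
  using Dvar_add[OF cont_diff_series_diff[OF assms(1,2)] assms(2-)] by simp

lemma Dvar_sum:
  assumes "\<And>a. a \<in> A \<Longrightarrow> cont_diff_series 1 (F a)" "z \<in> S" "i \<le> N"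
  shows "Dvar i (\<lambda>w. \<Sum>a\<in>A. F a w) z = (\<Sum>a\<in>A. Dvar i (F a) z)"
  using assms
proof (induction A rule: infinite_finite_induct)
  case (insert a A)
  then show ?case
    using Dvar_add[OF insert.prems(1) cont_diff_series_sum[of A 1 F]] by simp
qed auto

lemma Dvar_commute:
  assumes "cont_diff_series 2 F" "z \<in> S" "i \<le> N" "j \<le> N"
  shows "Dvar i (Dvar j F) z = Dvar j (Dvar i F) z"
proof (rule fls_eqI)
  fix k
  have F: "cont_diff_series (Suc (Suc 0)) F" using assms(1) by (simp add: numeral_2_eq_2)
  have swap: "Dvar i (Dvar j F) z $$ k = pderiv_at i (pderiv_at j (\<lambda>w. F w $$ k)) z"
    if "i \<le> N" "j \<le> N" for i j
    using Dvar_nth[OF cont_diff_series_Dvar[OF F that(2)] assms(2) that(1)]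
      pderiv_at_cong[OF Dvar_nth[OF F _ that(2)] assms(2) that(1)] by simp
  show "Dvar i (Dvar j F) z $$ k = Dvar j (Dvar i F) z $$ k"
    using pderiv_at_commute[OF cont_diff_series_nth[OF assms(1)] assms(2,3,4)]
    by (simp only: swap assms(3,4))
qed

lemma Dvar_Dp:
  assumes "cont_diff_series 1 F" "z \<in> S" "i \<le> N"
  shows "Dvar i (Dp F) z = Dp (Dvar i F) z"
proof (rule fls_eqI)
  fix k
  show "Dvar i (Dp F) z $$ k = Dp (Dvar i F) z $$ k"
    using pderiv_at_cmult[OF cont_diff_series_nth[OF assms(1)] assms(2,3)]
    by (simp add: Dvar_nth[OF cont_diff_series_Dp[OF assms(1)] assms(2,3)] Dp_nth Dvar_nth[OF assms])
qed

end

section \<open>The Lax--Sato flows\<close>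

text \<open>Suffixes denote derivatives, mixed ones being identified. The left side is the time
  derivative of {L, M} with both flows inserted; the terms in \<open>Ap\<close> and
  \<open>Bx\<close> cancel by antisymmetry of the bracket, and the rest groups into derivatives of
  \<open>A * J\<close> and \<open>B * J\<close>.\<close>

lemma lax_sato_J0_identity:
  fixes A Ax Ap B Bx Bp Lx Lp Lxx Lxp Lpp Mx Mp Mxx Mxp Mpp :: "'a::comm_ring"
  shows "(Ap * Lx + A * Lxp - (Bp * Lp + B * Lpp)) * Mx + Lp * (Ax * Mx + A * Mxx - (Bx * Mp + B * Mxp))
      - ((Ax * Lx + A * Lxx - (Bx * Lp + B * Lxp)) * Mp + Lx * (Ap * Mx + A * Mxp - (Bp * Mp + B * Mpp)))
    = Ax * (Lp * Mx - Lx * Mp) + A * (Lxp * Mx + Lp * Mxx - (Lxx * Mp + Lx * Mxp))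
      - (Bp * (Lp * Mx - Lx * Mp) + B * (Lpp * Mx + Lp * Mxp - (Lxp * Mp + Lx * Mpp)))"
  by (simp add: algebra_simps)

text \<open>Each derivation sends the inverse G to minus G^2 times the derivative of J. Multiplying
  the equation for J by - G^2 thus keeps the sign of the transport terms and flips that of the terms
  in \<open>Ax\<close> and \<open>Bp\<close>, which yields the brackets.\<close>

lemma inverse_transport_identity:
  fixes J Jt Jx Jp G Gt Gx Gp A Ax B Bp :: "'a::comm_ring_1"
  assumes "J * G = 1"
    and t: "Jt * G + J * Gt = 0" and x: "Jx * G + J * Gx = 0" and p: "Jp * G + J * Gp = 0"
    and J: "Jt = Ax * J + A * Jx - (Bp * J + B * Jp)"
  shows "Gt = (A * Gx - Ax * G) - (B * Gp - Bp * G)"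
proof -
  have inv: "X = - (G * G * Y)" if "Y * G + J * X = 0" for X Y
  proof -
    have "X = (J * G) * X" using assms(1) by simp
    also have "\<dots> = G * (J * X)" by (simp add: mult_ac)
    also have "J * X = - (Y * G)" using that by (simp add: add_eq_0_iff)
    finally show ?thesis by (simp add: mult_ac)
  qed
  have "G * G * J = G" using assms(1) by (metis mult.assoc mult.commute mult_1_right)
  hence "G * G * (Ax * J + A * Jx - (Bp * J + B * Jp))
      = Ax * G + A * (G * G * Jx) - (Bp * G + B * (G * G * Jp))"
    by (simp add: algebra_simps)
  thus ?thesis unfolding inv[OF t] inv[OF x] inv[OF p] J by (simp add: algebra_simps)
qed

section \<open>Regularity of L and M on a slice\<close>

locale lax_pair = open_slice +
  fixes u v :: "nat \<Rightarrow> point \<Rightarrow> real"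
  assumes u: "\<And>n m. n \<ge> 1 \<Longrightarrow> cont_diff m (u n)"
    and v: "\<And>n m. n \<ge> 1 \<Longrightarrow> cont_diff m (v n)"
begin

abbreviation "L \<equiv> Lax u"
abbreviation "M \<equiv> Orlov u v"
abbreviation "J \<equiv> J0 u v"

text \<open>On the slice all nonzero times have index at most \<open>N\<close>. A fixed range thus
  replaces the point-dependent index set of \<open>Orlov\<close>, and the sum can be differentiated
  termwise.\<close>

definition time_part :: series where
  "time_part z = (\<Sum>n=1..N. fls_const (real n * z n) * L z ^ (n - 1))"

definition tail_part :: series where
  "tail_part z = (\<Sum>n. fls_const (v (Suc n) z) * inverse (L z) ^ Suc n)"

lemma Lax_tail:
  shows "cont_diff_series m (\<lambda>z. \<Sum>n. fls_const (u (Suc n) z) * fls_X ^ Suc n)"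
    and "z \<in> S \<Longrightarrow> vanishes_below 1 (\<Sum>n. fls_const (u (Suc n) z) * fls_X ^ Suc n)"
proof -
  have X: "vanishes_below 1 (fls_X :: real fls)" by (simp add: vanishes_below_def)
  have cX: "cont_diff_series m (\<lambda>z. fls_X)"
    unfolding cont_diff_series_def using X cont_diff_const by blast
  show "cont_diff_series m (\<lambda>z. \<Sum>n. fls_const (u (Suc n) z) * fls_X ^ Suc n)"
    by (rule cont_diff_series_power_sum(1)[OF u cX X]) simp
  show "vanishes_below 1 (\<Sum>n. fls_const (u (Suc n) z) * fls_X ^ Suc n)" if "z \<in> S"
    by (rule cont_diff_series_power_sum(2)[OF u cX X that]) simp
qed

lemma Lax_nth: "z \<in> S \<Longrightarrow> k < 1 \<Longrightarrow> L z $$ k = (if k = -1 then 1 else 0)"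
  by (simp add: Lax_def vanishes_belowD[OF Lax_tail(2)] del: power_Suc)

lemma vanishes_below_Lax: "z \<in> S \<Longrightarrow> vanishes_below (-1) (L z)"
  by (simp add: vanishes_below_def Lax_nth)

lemma cont_diff_series_Lax: "cont_diff_series m L"
proof -
  have "vanishes_below (-1) (fls_X_inv :: real fls)" by (simp add: vanishes_below_def)
  hence "cont_diff_series m (\<lambda>z. fls_X_inv)"
    unfolding cont_diff_series_def using cont_diff_const by blast
  from cont_diff_series_add[OF this Lax_tail(1)] show ?thesis
    by (rule cont_diff_series_cong) (simp add: Lax_def)
qed

lemma cont_diff_series_tail_part: "cont_diff_series m tail_part"
  and vanishes_below_tail_part: "z \<in> S \<Longrightarrow> vanishes_below 1 (tail_part z)"
proof -
  have one: "L z $$ (-1) = 1" if "z \<in> S" for z using Lax_nth[OF that] by simp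
  have inv: "cont_diff_series m (\<lambda>z. inverse (L z))" for m
    by (rule cont_diff_series_inverse(1)[OF cont_diff_series_Lax vanishes_below_Lax one])
  have v1: "vanishes_below 1 (inverse (L z))" if "z \<in> S" for z
    using cont_diff_series_inverse(2)[OF cont_diff_series_Lax vanishes_below_Lax one that] by simp
  show "cont_diff_series m tail_part"
    unfolding tail_part_def[abs_def]
    by (rule cont_diff_series_power_sum(1)[OF v inv v1]) simp_all
  show "vanishes_below 1 (tail_part z)" if "z \<in> S"
    unfolding tail_part_def
    by (rule cont_diff_series_power_sum(2)[OF v inv v1 that]) simp_all
qed

lemma cont_diff_series_time_part: "cont_diff_series m time_part"
  unfolding time_part_def[abs_def]
  by (intro cont_diff_series_sum cont_diff_series_mult cont_diff_series_const cont_diff_series_power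
      cont_diff_mult cont_diff_const cont_diff_coordinate cont_diff_series_Lax)

lemma Orlov_eq:
  assumes "z \<in> S"
  shows "M z = fls_const (z 0) + time_part z + tail_part z"
proof -
  have "z \<in> slice N" using assms openin_imp_subset[OF open_S] by auto
  hence "{n. 1 \<le> n \<and> z n \<noteq> 0} \<subseteq> {1..N}"
    by (auto simp: slice_def) (metis not_le)
  hence "(\<Sum>n\<in>{n. 1 \<le> n \<and> z n \<noteq> 0}. fls_const (real n * z n) * L z ^ (n - 1)) = time_part z"
    unfolding time_part_def by (intro sum.mono_neutral_left) auto
  thus ?thesis by (simp add: Orlov_def tail_part_def)
qed

lemma cont_diff_series_Orlov: "cont_diff_series m M"
proof (rule cont_diff_series_cong)
  show "cont_diff_series m (\<lambda>z. fls_const (z 0) + time_part z + tail_part z)"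
    by (intro cont_diff_series_add cont_diff_series_const cont_diff_coordinate
        cont_diff_series_time_part cont_diff_series_tail_part)
qed (simp add: Orlov_eq)

lemma cont_diff_series_J0: "cont_diff_series m J"
  unfolding J0_def[abs_def]
  by (intro cont_diff_series_diff cont_diff_series_mult cont_diff_series_Dp cont_diff_series_Dvar
      cont_diff_series_Lax cont_diff_series_Orlov) simp_all

section \<open>The leading coefficient and invertibility of J_0\<close>

text \<open>The time part is a polynomial in L whose coefficients depend on neither x nor p, so its
  Poisson bracket with L vanishes.\<close>

lemma time_part_bracket:
  assumes z: "z \<in> S"
  shows "Dp L z * Dx time_part z = Dx L z * Dp time_part z"
proof -
  have cL: "cont_diff_series 1 (\<lambda>w. L w ^ k)" for k
    by (intro cont_diff_series_power cont_diff_series_Lax)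
  have pow: "Dp L z * Dx (\<lambda>w. L w ^ k) z = Dx L z * Dp (\<lambda>w. L w ^ k) z" for k
  proof (induction k)
    case 0
    show ?case using Dp_const[of "\<lambda>_. 1" z] by simp
  next
    case (Suc k)
    have "Dx (\<lambda>w. L w ^ Suc k) z = Dx L z * L z ^ k + L z * Dx (\<lambda>w. L w ^ k) z"
      using Dvar_mult[OF cont_diff_series_Lax cL z] by simp
    moreover have "Dp (\<lambda>w. L w ^ Suc k) z = Dp L z * L z ^ k + L z * Dp (\<lambda>w. L w ^ k) z"
      using Dp_mult by simp
    ultimately show ?case using Suc by (simp add: distrib_left mult.left_commute)
  qed
  have cc: "cont_diff m (\<lambda>w. real n * w n)" for m n
    by (intro cont_diff_mult cont_diff_const cont_diff_coordinate)
  \<comment> \<open>Since n \<ge> 1, the time \<open>z n\<close> is a coordinate different from x,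
    which is \<open>z 0\<close>.\<close>
  have Dx0: "Dx (\<lambda>w. fls_const (real n * w n)) z = 0" if "n \<ge> 1" for n
    using that by (subst Dvar_fls_const[OF cc z]) (simp_all add: pderiv_at_def)
  have "Dx time_part z = (\<Sum>n=1..N. Dx (\<lambda>w. fls_const (real n * w n) * L w ^ (n - 1)) z)"
    unfolding time_part_def[abs_def]
    by (intro Dvar_sum cont_diff_series_mult cont_diff_series_const cc cL z) simp
  also have "\<dots> = (\<Sum>n=1..N. fls_const (real n * z n) * Dx (\<lambda>w. L w ^ (n - 1)) z)"
    by (intro sum.cong refl)
       (simp add: Dvar_mult[OF cont_diff_series_const[OF cc] cL z] Dx0)
  finally have x: "Dx time_part z
      = (\<Sum>n=1..N. fls_const (real n * z n) * Dx (\<lambda>w. L w ^ (n - 1)) z)" .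
  have p: "Dp time_part z = (\<Sum>n=1..N. fls_const (real n * z n) * Dp (\<lambda>w. L w ^ (n - 1)) z)"
    unfolding time_part_def[abs_def] by (simp add: Dp_sum Dp_mult)
  show ?thesis
    unfolding x p sum_distrib_left
    by (simp only: mult.left_commute[of _ "fls_const _"] pow)
qed

text \<open>The bracket of L with x is the p-derivative of L, which starts with 1; the time part
  contributes nothing, and the tail only negative powers of p.\<close>

lemma J0_leading:
  assumes z: "z \<in> S"
  shows "vanishes_below 0 (J z)" and "J z $$ 0 = 1"
proof -
  have Lx: "vanishes_below 1 (Dx L z)"
    unfolding vanishes_below_def
  proof (intro allI impI)
    fix k :: int assume "k < 1"
    \<comment> \<open>Coefficients of L at non-negative powers of p are constants, so the
      x-derivative starts at X.\<close>
    have "pderiv_at 0 (\<lambda>w. L w $$ k) z = pderiv_at 0 (\<lambda>w. if k = -1 then 1 else 0) z"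
      using Lax_nth \<open>k < 1\<close> z by (intro pderiv_at_cong) auto
    thus "Dx L z $$ k = 0" by (simp add: Dvar_nth[OF cont_diff_series_Lax[of 0] z])
  qed
  have Lp: "vanishes_below 0 (Dp L z)" using vanishes_below_Dp[of "-1" L z] vanishes_below_Lax[OF z] by simp
  have Lp0: "Dp L z $$ 0 = 1" using z by (simp add: Dp_nth Lax_nth)
  have Qx: "vanishes_below 1 (Dx tail_part z)"
    by (rule vanishes_below_Dvar[OF cont_diff_series_tail_part[of 0] z])
       (simp_all add: vanishes_below_tail_part)
  have Qp: "vanishes_below 2 (Dp tail_part z)"
    using vanishes_below_Dp[of 1 tail_part z] vanishes_below_tail_part[OF z] by simp
  have "Dx M z = Dx (\<lambda>z. fls_const (z 0) + time_part z + tail_part z) z"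
    by (rule Dvar_cong[OF Orlov_eq z]) auto
  also have "\<dots> = Dx (\<lambda>z. fls_const (z 0)) z + Dx time_part z + Dx tail_part z"
    using z by (simp add: Dvar_add cont_diff_series_add cont_diff_series_const cont_diff_coordinate
      cont_diff_series_time_part cont_diff_series_tail_part del: One_nat_def)
  also have "Dx (\<lambda>z. fls_const (z 0)) z = fls_const (pderiv_at 0 (\<lambda>z. z 0) z)"
    by (rule Dvar_fls_const[OF cont_diff_coordinate[of 0] z]) simp
  also have "pderiv_at 0 (\<lambda>z. z 0) z = 1" by (simp add: pderiv_at_def)
  finally have Mx: "Dx M z = 1 + Dx time_part z + Dx tail_part z" by simp
  have "Dp M z = Dp (\<lambda>z. fls_const (z 0) + time_part z + tail_part z) z"
    by (rule Dp_cong) (rule Orlov_eq[OF z])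
  hence Mp: "Dp M z = Dp time_part z + Dp tail_part z" by (simp add: Dp_add)
  define R where "R = Dp L z * Dx tail_part z - Dx L z * Dp tail_part z"
  have "vanishes_below 1 (Dx L z * Dp tail_part z)"
    by (rule vanishes_below_mono[OF vanishes_below_mult[OF Lx Qp]]) simp
  hence R: "vanishes_below 1 R"
    unfolding R_def using vanishes_below_mult[OF Lp Qx] by (intro vanishes_below_diff) auto
  \<comment> \<open>The summand 1 in \<open>Mx\<close> is the derivative of the explicit x and gives
    \<open>Dp L z\<close>; the time part cancels and \<open>R\<close> collects the tail.\<close>
  have "J z = Dp L z + R"
    using time_part_bracket[OF z] by (simp add: J0_def Mx Mp R_def algebra_simps)
  thus "vanishes_below 0 (J z)" "J z $$ 0 = 1"
    using Lp Lp0 R by (auto simp: vanishes_below_def)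
qed

lemma cont_diff_series_inverse_J0: "cont_diff_series m (\<lambda>z. inverse (J z))"
  and J0_right_inverse: "z \<in> S \<Longrightarrow> J z * inverse (J z) = 1"
  by (rule cont_diff_series_inverse[OF cont_diff_series_J0 J0_leading]; assumption)+

lemma cont_diff_series_Acoef: "cont_diff_series m (Acoef u v n)"
  unfolding Acoef_def[abs_def]
  by (intro cont_diff_series_poly_part cont_diff_series_mult cont_diff_series_inverse_J0 cont_diff_series_Dp
      cont_diff_series_power cont_diff_series_Lax)

lemma cont_diff_series_Bcoef: "cont_diff_series m (Bcoef u v n)"
  unfolding Bcoef_def[abs_def]
  by (intro cont_diff_series_poly_part cont_diff_series_mult cont_diff_series_inverse_J0 cont_diff_series_Dvar
      cont_diff_series_power cont_diff_series_Lax) simp_all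

section \<open>Evolution of J_0 and of its inverse\<close>

text \<open>The flow equations are required on all of \<open>S\<close> because they get
  differentiated in x. For the p-derivative their validity at \<open>z\<close> suffices, since
  \<open>Dp\<close> acts on the series at a single point.\<close>

lemma Dt_J0:
  assumes z: "z \<in> S" and n: "n \<le> N"
    and flow: "\<And>w. w \<in> S \<Longrightarrow> Dt n L w = Acoef u v n w * Dx L w - Bcoef u v n w * Dp L w"
      "\<And>w. w \<in> S \<Longrightarrow> Dt n M w = Acoef u v n w * Dx M w - Bcoef u v n w * Dp M w"
  shows "Dt n J z = Dx (\<lambda>w. Acoef u v n w * J w) z - Dp (\<lambda>w. Bcoef u v n w * J w) z"
proof -
  define A B where "A = Acoef u v n" and "B = Bcoef u v n"
  have flow': "\<forall>w\<in>S. Dt n L w = A w * Dx L w - B w * Dp L w"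
    "\<forall>w\<in>S. Dt n M w = A w * Dx M w - B w * Dp M w"
    using flow by (simp_all add: A_def B_def)
  have cA: "cont_diff_series m A" and cB: "cont_diff_series m B" for m
    by (simp_all add: A_def B_def cont_diff_series_Acoef cont_diff_series_Bcoef)
  have Jdef: "J = (\<lambda>w. Dp L w * Dx M w - Dx L w * Dp M w)"
    by (rule ext) (rule J0_def)
  have L: "cont_diff_series m L" and M: "cont_diff_series m M" for m
    by (rule cont_diff_series_Lax cont_diff_series_Orlov)+
  note N0 = le0[of N]
  have cx: "cont_diff_series m (Dx F)" and cp: "cont_diff_series m (Dp F)"
    if "\<And>m. cont_diff_series m F" for F m
    using that cont_diff_series_Dvar cont_diff_series_Dp by blast+
  have D_J: "Dvar i J z = (Dvar i (Dp L) z * Dx M z + Dp L z * Dvar i (Dx M) z)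
      - (Dvar i (Dx L) z * Dp M z + Dx L z * Dvar i (Dp M) z)" if "i \<le> N" for i
    unfolding Jdef using z that
    by (simp add: Dvar_diff Dvar_mult cont_diff_series_mult cx cp L M del: One_nat_def)
  have px: "Dx (Dp F) z = Dp (Dx F) z" if "\<And>m. cont_diff_series m F" for F
    using Dvar_Dp[OF that z N0] .
  \<comment> \<open>Moving the time derivative inside and applying the flow of F leaves only x- and
    p-derivatives; the same computation serves L and M.\<close>
  have flow_p: "Dt n (Dp F) z = Dp A z * Dx F z + A z * Dp (Dx F) z - (Dp B z * Dp F z + B z * Dp (Dp F) z)"
    and flow_x: "Dt n (Dx F) z = Dx A z * Dx F z + A z * Dx (Dx F) z - (Dx B z * Dp F z + B z * Dp (Dx F) z)"
    if F: "\<And>m. cont_diff_series m F"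
      and Ft: "\<forall>w\<in>S. Dt n F w = A w * Dx F w - B w * Dp F w" for F
  proof -
    have "Dt n (Dp F) z = Dp (Dt n F) z" by (rule Dvar_Dp[OF F z n])
    also have "\<dots> = Dp (\<lambda>w. A w * Dx F w - B w * Dp F w) z" by (rule Dp_cong) (rule bspec[OF Ft z])
    finally show "Dt n (Dp F) z
        = Dp A z * Dx F z + A z * Dp (Dx F) z - (Dp B z * Dp F z + B z * Dp (Dp F) z)"
      by (simp add: Dp_diff Dp_mult)
    have "Dt n (Dx F) z = Dx (Dt n F) z" by (rule Dvar_commute[OF F z n N0])
    also have "\<dots> = Dx (\<lambda>w. A w * Dx F w - B w * Dp F w) z" by (rule Dvar_cong[OF bspec[OF Ft] z N0])
    finally show "Dt n (Dx F) z
        = Dx A z * Dx F z + A z * Dx (Dx F) z - (Dx B z * Dp F z + B z * Dp (Dx F) z)"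
      using z by (simp add: Dvar_diff Dvar_mult cont_diff_series_mult cx cp cA cB F px
          del: One_nat_def)
  qed
  note flows = flow_p[OF L flow'(1)] flow_x[OF L flow'(1)] flow_p[OF M flow'(2)] flow_x[OF M flow'(2)]
  have Dp_J: "Dp J z = (Dp (Dp L) z * Dx M z + Dp L z * Dp (Dx M) z)
      - (Dp (Dx L) z * Dp M z + Dx L z * Dp (Dp M) z)"
    unfolding Jdef by (simp add: Dp_diff Dp_mult)
  have "Dt n J z = Dx A z * J z + A z * Dx J z - (Dp B z * J z + B z * Dp J z)"
    \<comment> \<open>After ordering all mixed derivatives as p after x, both sides are polynomials
      in the same derivatives at \<open>z\<close>.\<close>
    unfolding D_J[OF n] D_J[OF N0] flows px[OF L] px[OF M] Dp_J J0_def
    by (rule lax_sato_J0_identity)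
  also have "\<dots> = Dx (\<lambda>w. A w * J w) z - Dp (\<lambda>w. B w * J w) z"
    by (simp only: Dvar_mult[OF cA cont_diff_series_J0 z N0] Dp_mult)
  finally show ?thesis by (simp only: A_def B_def)
qed

text \<open>The product of J_0 and its inverse is constantly 1 on \<open>S\<close>, so its
  derivatives in time, x and p vanish; these are the inputs of
  \<open>inverse_transport_identity\<close>.\<close>

lemma Dt_J0_inv:
  assumes z: "z \<in> S" and n: "n \<le> N"
    and flow: "Dt n J z = Dx (\<lambda>w. Acoef u v n w * J w) z - Dp (\<lambda>w. Bcoef u v n w * J w) z"
  shows "Dt n (J0_inv u v) z
    = bracket Dx (Acoef u v n) (J0_inv u v) z - bracket Dp (Bcoef u v n) (J0_inv u v) z"
proof -
  define G where "G = J0_inv u v"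
  have G: "cont_diff_series m G" for m
    unfolding G_def J0_inv_def[abs_def] by (rule cont_diff_series_inverse_J0)
  have JG: "J w * G w = 1" if "w \<in> S" for w
    using J0_right_inverse[OF that] by (simp add: G_def J0_inv_def)
  have D: "Dvar i J z * G z + J z * Dvar i G z = 0" if "i \<le> N" for i
    using Dvar_mult[OF cont_diff_series_J0 G z that] Dvar_cong[OF JG z that] by simp
  have "Dp (\<lambda>w. J w * G w) z = Dp (\<lambda>w. fls_const 1) z"
    by (rule Dp_cong) (simp add: JG[OF z])
  hence Dp: "Dp J z * G z + J z * Dp G z = 0" by (simp only: Dp_mult Dp_const)
  have "Dx (\<lambda>w. Acoef u v n w * J w) z = Dx (Acoef u v n) z * J z + Acoef u v n z * Dx J z"
    by (rule Dvar_mult[OF cont_diff_series_Acoef cont_diff_series_J0 z]) simp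
  from inverse_transport_identity[OF JG[OF z] D[OF n] D[OF le0] Dp flow[unfolded this Dp_mult]]
  show ?thesis by (simp add: bracket_def G_def)
qed

end

section \<open>Reduction to a single slice\<close>

theorem proposition2p3:
  fixes u v :: "nat \<Rightarrow> point \<Rightarrow> real" and D :: "point set"
  assumes "open_domain D"
    and "\<And>n. n \<ge> 1 \<Longrightarrow> smooth_in D (u n)"
    and "\<And>n. n \<ge> 1 \<Longrightarrow> smooth_in D (v n)"
    and "\<And>n. n \<ge> 1 \<Longrightarrow> via_t1_plus_x D (u n)"
    and "\<And>n. n \<ge> 1 \<Longrightarrow> via_t1_plus_x D (v n)"
    and "lax_sato D u v"
  shows "\<forall>n\<ge>1. \<forall>z\<in>D.
           Dt n (J0 u v) z
             = Dx (\<lambda>w. Acoef u v n w * J0 u v w) z - Dp (\<lambda>w. Bcoef u v n w * J0 u v w) z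
         \<and> Dt n (J0_inv u v) z
             = bracket Dx (Acoef u v n) (J0_inv u v) z - bracket Dp (Bcoef u v n) (J0_inv u v) z"
proof (intro allI impI ballI)
  fix n :: nat and z assume n: "1 \<le> n" and z: "z \<in> D"
  obtain K where K: "z \<in> slice K"
    using assms(1) z unfolding open_domain_def by blast
  \<comment> \<open>The slice has to contain the point \<open>z\<close> and also the direction of
    the n-th time, in which \<open>z\<close> may have a zero entry.\<close>
  define N where "N = max K n"
  have zS: "z \<in> D \<inter> slice N" and nN: "n \<le> N"
    using K z by (auto simp: N_def slice_def)
  interpret lax_pair N "D \<inter> slice N" u v
  proof
    show "openin (top_of_set (slice N)) (D \<inter> slice N)"
      using assms(1) unfolding open_domain_def by blast
  qed (use smooth_in_imp_cont_diff assms(1,2,3) in blast)+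
  have flow: "Dt n F w = Acoef u v n w * Dx F w - Bcoef u v n w * Dp F w"
    if "F \<in> {Lax u, Orlov u v}" "w \<in> D \<inter> slice N" for F w
    using assms(6) n that unfolding lax_sato_def by blast
  have "Dt n (J0 u v) z
      = Dx (\<lambda>w. Acoef u v n w * J0 u v w) z - Dp (\<lambda>w. Bcoef u v n w * J0 u v w) z"
    by (rule Dt_J0[OF zS nN flow flow]) simp_all
  with Dt_J0_inv[OF zS nN this]
  show "Dt n (J0 u v) z
      = Dx (\<lambda>w. Acoef u v n w * J0 u v w) z - Dp (\<lambda>w. Bcoef u v n w * J0 u v w) z
    \<and> Dt n (J0_inv u v) z
      = bracket Dx (Acoef u v n) (J0_inv u v) z - bracket Dp (Bcoef u v n) (J0_inv u v) z"
    by blast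
qed

end
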